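(* Let $d\in\mathbb{N}$, let $D=\prod_{i=1}^d [a_i,b_i]$ with $a_i<b_i$, let $\mathcal F$ be a real vector space of functions $D\to\mathbb{R}$ with $C^2(D)\subseteq\mathcal F$, and let $P_1,\dots,P_d:\mathcal F\to\mathcal F$ be linear projections such that (a) $P_iP_jf=P_jP_if$ for all $i,j\in[d]$ and $f\in\mathcal F$; (b) $P_jf$ is independent of the $j$-th variable $x_j$ for all $f\in\mathcal F$; (c) $P_jf=f$ whenever $f\in\mathcal F$ is independent of $x_j$. Let $f\in C^2(D)$, and let $f=\sum_{\mathbf u\subseteq[d]}f_{\mathbf u}$ be the decomposition with summands $$f_{\mathbf u}:=\prod_{j\in\mathbf u}(\mathrm{Id}-P_j)\prod_{j\in[d]\setminus\mathbf u}P_j\, f .$$ If $\partial^2_{x_i,x_j}f=0$ on $D$ for some $i\neq j$, then $f_{\mathbf u}=0$ for all $\mathbf u\subseteq[d]$ with $\{i,j\}\subseteq\mathbf u$. Moreover, $$f(x)=\sum_{\mathbf u\ \text{clique of}\ \mathcal G(f)}f_{\mathbf u}(x_{\mathbf u}),\qquad x\in D.$$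
   Context: $[d]=\{1,\dots,d\}$. For $\mathbf u\subseteq[d]$, $x_{\mathbf u}=(x_i)_{i\in\mathbf u}$; the function $f_{\mathbf u}$ depends only on $x_{\mathbf u}$. For $f\in C^2(D)$ the undirected graph $\mathcal G(f)$ has vertex set $\mathcal V(f)=\{i\in[d]:\partial_{x_i}f\neq0\}$ and edge set $\mathcal E(f)=\{(i,j)\in[d]^2: i\neq j,\ \partial^2_{x_i,x_j}f\neq 0\}$, where $\neq0$ means "not identically zero on $D$". A clique of $\mathcal G(f)$ is a subset of $\mathcal V(f)$ any two distinct elements of which are connected by an edge; the empty set and single vertices are cliques. *)

theory Defs
  imports "HOL-Analysis.Analysis"
begin

text \<open>
  Real functions on a set \<open>D\<close> are elements of \<^term>\<open>extensional D\<close>, so that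
  HOL equality of two of them is equality on \<open>D\<close>.  The index set \<open>[d]\<close> is the universe of a
  finite type.
\<close>

definition function_space :: "'a set \<Rightarrow> ('a \<Rightarrow> real) set \<Rightarrow> bool" where
  "function_space D F \<longleftrightarrow>
     F \<subseteq> extensional D \<and>
     (\<lambda>x\<in>D. 0) \<in> F \<and>
     (\<forall>g\<in>F. \<forall>h\<in>F. (\<lambda>x\<in>D. g x + h x) \<in> F) \<and>
     (\<forall>c. \<forall>g\<in>F. (\<lambda>x\<in>D. c * g x) \<in> F)"

definition linear_projection_on ::
    "'a set \<Rightarrow> ('a \<Rightarrow> real) set \<Rightarrow> (('a \<Rightarrow> real) \<Rightarrow> 'a \<Rightarrow> real) \<Rightarrow> bool" where
  "linear_projection_on D F T \<longleftrightarrow>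
     T \<in> F \<rightarrow> F \<and>
     (\<forall>g\<in>F. \<forall>h\<in>F. T (\<lambda>x\<in>D. g x + h x) = (\<lambda>x\<in>D. T g x + T h x)) \<and>
     (\<forall>c. \<forall>g\<in>F. T (\<lambda>x\<in>D. c * g x) = (\<lambda>x\<in>D. c * T g x)) \<and>
     (\<forall>g\<in>F. T (T g) = T g)"

definition depends_only_on :: "(real ^ 'd) set \<Rightarrow> 'd set \<Rightarrow> (real ^ 'd \<Rightarrow> real) \<Rightarrow> bool" where
  "depends_only_on D u g \<longleftrightarrow> (\<forall>x\<in>D. \<forall>y\<in>D. (\<forall>k\<in>u. x $ k = y $ k) \<longrightarrow> g x = g y)"

definition independent_of :: "(real ^ 'd) set \<Rightarrow> 'd \<Rightarrow> (real ^ 'd \<Rightarrow> real) \<Rightarrow> bool" where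
  "independent_of D j g \<longleftrightarrow> depends_only_on D (UNIV - {j}) g"

text \<open>
  Partial derivatives on \<open>D\<close> are taken along the line through \<open>x\<close> parallel to the \<open>i\<close>-th axis,
  within \<open>D\<close>; on the boundary of a box they are one-sided.
\<close>

definition partially_differentiable ::
    "(real ^ 'd) set \<Rightarrow> 'd::finite \<Rightarrow> (real ^ 'd \<Rightarrow> real) \<Rightarrow> bool" where
  "partially_differentiable D i f \<longleftrightarrow>
     (\<forall>x\<in>D. (\<lambda>t. f (x + t *\<^sub>R axis i 1)) differentiable
              (at 0 within {t. x + t *\<^sub>R axis i 1 \<in> D}))"

definition partial :: "(real ^ 'd) set \<Rightarrow> 'd::finite \<Rightarrow> (real ^ 'd \<Rightarrow> real) \<Rightarrow> real ^ 'd \<Rightarrow> real" where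
  "partial D i f =
     (\<lambda>x\<in>D. vector_derivative (\<lambda>t. f (x + t *\<^sub>R axis i 1))
              (at 0 within {t. x + t *\<^sub>R axis i 1 \<in> D}))"

definition partial2 ::
    "(real ^ 'd) set \<Rightarrow> 'd::finite \<Rightarrow> 'd \<Rightarrow> (real ^ 'd \<Rightarrow> real) \<Rightarrow> real ^ 'd \<Rightarrow> real" where
  "partial2 D i j f = partial D i (partial D j f)"

definition C2 :: "(real ^ 'd::finite) set \<Rightarrow> (real ^ 'd \<Rightarrow> real) set" where
  "C2 D = {f \<in> extensional D.
     continuous_on D f \<and>
     (\<forall>j. partially_differentiable D j f \<and> continuous_on D (partial D j f)) \<and>
     (\<forall>i j. partially_differentiable D i (partial D j f) \<and> continuous_on D (partial2 D i j f))}"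

definition graph_vertices :: "(real ^ 'd::finite) set \<Rightarrow> (real ^ 'd \<Rightarrow> real) \<Rightarrow> 'd set" where
  "graph_vertices D f = {i. \<exists>x\<in>D. partial D i f x \<noteq> 0}"

definition graph_edges :: "(real ^ 'd::finite) set \<Rightarrow> (real ^ 'd \<Rightarrow> real) \<Rightarrow> ('d \<times> 'd) set" where
  "graph_edges D f = {(i, j). i \<noteq> j \<and> (\<exists>x\<in>D. partial2 D i j f x \<noteq> 0)}"

definition is_clique :: "'v set \<Rightarrow> ('v \<times> 'v) set \<Rightarrow> 'v set \<Rightarrow> bool" where
  "is_clique V E u \<longleftrightarrow> u \<subseteq> V \<and> (\<forall>i\<in>u. \<forall>j\<in>u. i \<noteq> j \<longrightarrow> (i, j) \<in> E)"

text \<open>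
  Product (composition) of the operators \<open>T j\<close> over \<open>j \<in> u\<close>, in an arbitrarily chosen order.  It is
  meant for operators that commute on the functions they are applied to, so that the choice is
  immaterial.
\<close>

definition op_prod :: "('i \<Rightarrow> 'g \<Rightarrow> 'g) \<Rightarrow> 'i set \<Rightarrow> 'g \<Rightarrow> 'g" where
  "op_prod T u = foldr T (SOME js. distinct js \<and> set js = u)"

definition id_minus :: "'a set \<Rightarrow> (('a \<Rightarrow> real) \<Rightarrow> 'a \<Rightarrow> real) \<Rightarrow> ('a \<Rightarrow> real) \<Rightarrow> 'a \<Rightarrow> real" where
  "id_minus D T g = (\<lambda>x\<in>D. g x - T g x)"

definition summand ::
    "(real ^ 'd) set \<Rightarrow> ('d::finite \<Rightarrow> (real ^ 'd \<Rightarrow> real) \<Rightarrow> real ^ 'd \<Rightarrow> real) \<Rightarrow>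
     (real ^ 'd \<Rightarrow> real) \<Rightarrow> 'd set \<Rightarrow> real ^ 'd \<Rightarrow> real" where
  "summand D P f u = op_prod (\<lambda>j. id_minus D (P j)) u (op_prod P (UNIV - u) f)"

end

theory Submission
  imports Defs
begin

text \<open>
  If \<open>\<partial>\<^sub>i\<partial>\<^sub>j f = 0\<close>, then \<open>f = g + h\<close> where \<open>g\<close> is \<open>f\<close> with \<open>x\<^sub>i\<close> frozen at \<open>a\<^sub>i\<close>: by construction \<open>g\<close> is
  independent of \<open>x\<^sub>i\<close>, and \<open>h = f - g\<close> is independent of \<open>x\<^sub>j\<close> because \<open>\<partial>\<^sub>j f\<close> is independent of \<open>x\<^sub>i\<close>.
  Since \<open>g\<close> is again \<open>C\<^sup>2\<close>, both parts lie in \<open>F\<close>, and \<open>(Id - P\<^sub>i)(Id - P\<^sub>j)\<close> annihilates each of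
  them.  All operators commute, so every summand whose index set contains \<open>i\<close> and \<open>j\<close> vanishes.
  Expanding \<open>\<Prod>\<^sub>j ((Id - P\<^sub>j) + P\<^sub>j) = Id\<close> gives the decomposition, in which the summands that are not
  indexed by cliques may be dropped.
\<close>

section \<open>Products of commuting operators\<close>

lemma foldr_closed:
  assumes "\<And>j h. h \<in> F \<Longrightarrow> T j h \<in> F" "g \<in> F"
  shows "foldr T js g \<in> F"
  using assms by (induction js) auto

text \<open>Commutation is only available on \<open>F\<close>, so the induction relies on every
  intermediate result staying in \<open>F\<close>.\<close>

lemma foldr_commute:
  assumes "\<And>j h. h \<in> F \<Longrightarrow> T j h \<in> F"
    and "\<And>j h. h \<in> F \<Longrightarrow> S (T j h) = T j (S h)"
    and "g \<in> F"
  shows "foldr T js (S g) = S (foldr T js g)"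
proof (induction js)
  case (Cons j js)
  have "foldr T js g \<in> F"
    using assms(1,3) by (rule foldr_closed)
  then show ?case
    using Cons assms(2) by simp
qed simp

text \<open>The head of \<open>js\<close> occurs somewhere in \<open>ks\<close> and can be moved to
  the front past the operators before it. This makes the arbitrary order chosen in
  \<open>op_prod\<close> immaterial.\<close>

lemma foldr_distinct_cong:
  assumes "\<And>j h. h \<in> F \<Longrightarrow> T j h \<in> F"
    and "\<And>i j h. h \<in> F \<Longrightarrow> T i (T j h) = T j (T i h)"
    and "g \<in> F" "distinct js" "distinct ks" "set js = set ks"
  shows "foldr T js g = foldr T ks g"
  using assms(4-6)
proof (induction js arbitrary: ks)
  case (Cons j js)
  then obtain ks1 ks2 where ks: "ks = ks1 @ j # ks2"
    by (metis list.set_intros(1) split_list)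
  have "foldr T ks2 g \<in> F"
    using assms(1,3) by (rule foldr_closed)
  then have "foldr T ks g = T j (foldr T (ks1 @ ks2) g)"
    unfolding ks using foldr_commute[of F T "T j" "foldr T ks2 g" ks1] assms(1,2) by simp
  moreover have "foldr T js g = foldr T (ks1 @ ks2) g"
    using Cons.prems ks by (intro Cons.IH) auto
  ultimately show ?case
    by simp
qed simp

lemma op_prod_list:
  assumes "finite u"
  obtains js where "distinct js" "set js = u" "op_prod T u = foldr T js"
proof -
  have "distinct (SOME js. distinct js \<and> set js = u) \<and> set (SOME js. distinct js \<and> set js = u) = u"
    by (rule someI_ex) (use finite_distinct_list[OF assms] in blast)
  then show ?thesis
    using that unfolding op_prod_def by blast
qed

lemma op_prod_empty [simp]: "op_prod T {} g = g"
  by (rule op_prod_list[of "{}" T]) auto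

lemma op_prod_closed:
  assumes "finite u" "\<And>j h. h \<in> F \<Longrightarrow> T j h \<in> F" "g \<in> F"
  shows "op_prod T u g \<in> F"
proof -
  obtain js where "op_prod T u = foldr T js"
    using op_prod_list[OF assms(1)] by metis
  then show ?thesis
    using foldr_closed[of F T g js] assms(2,3) by simp
qed

lemma op_prod_fixed:
  assumes "finite u" "\<And>j. T j z = z"
  shows "op_prod T u z = z"
  \<comment> \<open>A common fixed point is a closed set with one element.\<close>
  using op_prod_closed[of u "{z}" T z] assms by simp

lemma op_prod_commute:
  assumes "finite u"
    and "\<And>j h. h \<in> F \<Longrightarrow> T j h \<in> F"
    and "\<And>j h. h \<in> F \<Longrightarrow> S (T j h) = T j (S h)"
    and "g \<in> F"
  shows "op_prod T u (S g) = S (op_prod T u g)"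
proof -
  obtain js where "op_prod T u = foldr T js"
    using op_prod_list[OF assms(1)] by metis
  then show ?thesis
    using foldr_commute[of F T S g js] assms(2-4) by simp
qed

text \<open>The lists chosen for \<open>u\<close> and for \<open>insert j u\<close> are unrelated.
  Independence of the order allows \<open>j\<close> to be put in front of the former.\<close>

lemma op_prod_insert:
  assumes "finite u" "j \<notin> u"
    and "\<And>j h. h \<in> F \<Longrightarrow> T j h \<in> F"
    and "\<And>i j h. h \<in> F \<Longrightarrow> T i (T j h) = T j (T i h)"
    and "g \<in> F"
  shows "op_prod T (insert j u) g = T j (op_prod T u g)"
proof -
  obtain js where js: "distinct js" "set js = u" "op_prod T u = foldr T js"
    using op_prod_list[OF assms(1)] by metis
  obtain ks where ks: "distinct ks" "set ks = insert j u" "op_prod T (insert j u) = foldr T ks"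
    using op_prod_list[of "insert j u"] assms(1) by (metis finite_insert)
  have "foldr T ks g = foldr T (j # js) g"
    by (rule foldr_distinct_cong[of F]) (use assms js ks in auto)
  then show ?thesis
    using js ks by simp
qed

section \<open>Partial derivatives on a box\<close>

text \<open>The two functions have the same candidate derivatives, so the choice inside
  \<open>vector_derivative\<close> gives the same value even where no derivative exists.\<close>

lemma vector_derivative_within_cong:
  assumes "\<And>t. t \<in> S \<Longrightarrow> f t = g t" "x \<in> S"
  shows "vector_derivative f (at x within S) = vector_derivative g (at x within S)"
proof -
  have "(f has_vector_derivative y) (at x within S) \<longleftrightarrow> (g has_vector_derivative y) (at x within S)" for y
    using assms by (metis has_vector_derivative_transform)
  then show ?thesis
    unfolding vector_derivative_def by simp
qed

lemma differentiable_within_cong: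
  assumes "\<And>t. t \<in> S \<Longrightarrow> f t = g t" "x \<in> S"
  shows "f differentiable (at x within S) \<longleftrightarrow> g differentiable (at x within S)"
  using assms unfolding differentiable_def by (metis has_derivative_transform)

text \<open>The admissible parameters form an interval determined by the coordinate
  \<open>x $ i\<close> alone. This gives convexity, nontrivial limits at \<open>0\<close>, and
  invariance under changes of other coordinates.\<close>

lemma box_line:
  fixes a b x :: "real ^ 'd::finite"
  assumes "x \<in> cbox a b"
  shows "{t. x + t *\<^sub>R axis i 1 \<in> cbox a b} = {a $ i - x $ i .. b $ i - x $ i}"
proof -
  have x: "a $ k \<le> x $ k" "x $ k \<le> b $ k" for k
    using assms by (auto simp: mem_box_cart)
  have "x + t *\<^sub>R axis i 1 \<in> cbox a b \<longleftrightarrow> a $ i \<le> x $ i + t \<and> x $ i + t \<le> b $ i" for t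
  proof
    assume "x + t *\<^sub>R axis i 1 \<in> cbox a b"
    then have "a $ i \<le> (x + t *\<^sub>R axis i 1) $ i \<and> (x + t *\<^sub>R axis i 1) $ i \<le> b $ i"
      unfolding mem_box_cart by blast
    then show "a $ i \<le> x $ i + t \<and> x $ i + t \<le> b $ i"
      by simp
  next
    assume t: "a $ i \<le> x $ i + t \<and> x $ i + t \<le> b $ i"
    show "x + t *\<^sub>R axis i 1 \<in> cbox a b"
      unfolding mem_box_cart
    proof
      fix k
      show "a $ k \<le> (x + t *\<^sub>R axis i 1) $ k \<and> (x + t *\<^sub>R axis i 1) $ k \<le> b $ k"
        by (cases "k = i") (use t x[of k] in \<open>simp_all add: axis_def\<close>)
    qed
  qed
  then have "{t. x + t *\<^sub>R axis i 1 \<in> cbox a b} = {t. a $ i \<le> x $ i + t \<and> x $ i + t \<le> b $ i}"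
    by (rule Collect_cong)
  also have "\<dots> = {a $ i - x $ i .. b $ i - x $ i}"
    by auto
  finally show ?thesis .
qed

lemma has_partial:
  assumes "partially_differentiable D i f" "x \<in> D"
  shows "((\<lambda>t. f (x + t *\<^sub>R axis i 1)) has_vector_derivative partial D i f x)
           (at 0 within {t. x + t *\<^sub>R axis i 1 \<in> D})"
  using assms vector_derivative_works unfolding partially_differentiable_def partial_def by auto

text \<open>Two points differing only in coordinate \<open>i\<close> lie on one segment of the box,
  and a function with zero derivative along that segment is constant on it.\<close>

lemma independent_ofI:
  fixes a b :: "real ^ 'd::finite"
  assumes D: "D = cbox a b"
    and deriv: "\<And>x. x \<in> D \<Longrightarrow> ((\<lambda>t. f (x + t *\<^sub>R axis i 1)) has_vector_derivative 0)
                  (at 0 within {t. x + t *\<^sub>R axis i 1 \<in> D})"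
  shows "independent_of D i f"
  unfolding independent_of_def depends_only_on_def
proof (intro ballI impI)
  fix x y assume x: "x \<in> D" and y: "y \<in> D" and xy: "\<forall>k\<in>UNIV - {i}. x $ k = y $ k"
  define S where "S = {t. x + t *\<^sub>R axis i 1 \<in> D}"
  have y_eq: "y = x + (y $ i - x $ i) *\<^sub>R axis i 1"
    using xy by (auto simp: vec_eq_iff axis_def)
  \<comment> \<open>The hypothesis speaks of parameter \<open>0\<close> only. Applied at the base
    point \<open>z\<close> and shifted by \<open>s\<close>, it yields the derivative at any
    parameter \<open>s\<close>.\<close>
  have const: "((\<lambda>t. f (x + t *\<^sub>R axis i 1)) has_vector_derivative 0) (at s within S)" if s: "s \<in> S" for s
  proof -
    define z where "z = x + s *\<^sub>R axis i 1"
    have "z \<in> D"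
      using s by (simp add: S_def z_def)
    have img: "(\<lambda>t. t - s) ` S = {t. z + t *\<^sub>R axis i 1 \<in> D}"
    proof (intro equalityI subsetI)
      fix t assume "t \<in> {t. z + t *\<^sub>R axis i 1 \<in> D}"
      then have "t + s \<in> S"
        by (simp add: S_def z_def algebra_simps)
      then show "t \<in> (\<lambda>t. t - s) ` S"
        by (rule rev_image_eqI) simp
    qed (auto simp: S_def z_def algebra_simps)
    have "((\<lambda>t. t - s) has_vector_derivative 1) (at s within S)"
      by (auto intro!: derivative_eq_intros)
    moreover have "((\<lambda>t. f (z + t *\<^sub>R axis i 1)) has_vector_derivative 0)
                     (at (s - s) within (\<lambda>t. t - s) ` S)"
      using deriv[OF \<open>z \<in> D\<close>] img by simp
    ultimately have "((\<lambda>t. f (z + t *\<^sub>R axis i 1)) \<circ> (\<lambda>t. t - s) has_vector_derivative 1 *\<^sub>R 0)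
                       (at s within S)"
      by (rule vector_diff_chain_within)
    then show ?thesis
      by (simp add: z_def o_def algebra_simps)
  qed
  have "convex S"
    using x by (simp add: S_def D box_line)
  then obtain c where c: "\<And>t. t \<in> S \<Longrightarrow> f (x + t *\<^sub>R axis i 1) = c"
    by (rule has_vector_derivative_zero_constant) (rule const, assumption, blast)
  have "y $ i - x $ i \<in> S"
    unfolding S_def mem_Collect_eq y_eq[symmetric] by (rule y)
  then have "f y = c"
    using c[of "y $ i - x $ i"] unfolding y_eq[symmetric] by blast
  moreover have "f x = c"
    using c[of 0] x by (simp add: S_def)
  ultimately show "f x = f y"
    by simp
qed

lemma partial_zero_imp_independent_of:
  fixes a b :: "real ^ 'd::finite"
  assumes "D = cbox a b" "partially_differentiable D i f" "\<And>x. x \<in> D \<Longrightarrow> partial D i f x = 0"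
  shows "independent_of D i f"
  using assms has_partial[OF assms(2)] by (intro independent_ofI) auto

lemma independent_of_imp_partial_zero:
  fixes a b :: "real ^ 'd::finite"
  assumes ab: "\<And>i. a $ i < b $ i" and D: "D = cbox a b" and f: "independent_of D i f"
  shows "partially_differentiable D i f" "partial D i f = (\<lambda>x\<in>D. 0)"
proof -
  have *: "((\<lambda>t. f (x + t *\<^sub>R axis i 1)) has_vector_derivative 0)
             (at 0 within {t. x + t *\<^sub>R axis i 1 \<in> D})" if x: "x \<in> D" for x
  proof (rule has_vector_derivative_transform[OF _ _ has_vector_derivative_const[of "f x"]])
    fix t assume "t \<in> {t. x + t *\<^sub>R axis i 1 \<in> D}"
    moreover have "\<forall>k\<in>UNIV - {i}. (x + t *\<^sub>R axis i 1) $ k = x $ k"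
      by (simp add: axis_def)
    ultimately show "f (x + t *\<^sub>R axis i 1) = f x"
      using f x unfolding independent_of_def depends_only_on_def by blast
  qed (use x in simp)
  show "partially_differentiable D i f"
    unfolding partially_differentiable_def using * differentiableI_vector by blast
  have "vector_derivative (\<lambda>t. f (x + t *\<^sub>R axis i 1)) (at 0 within {t. x + t *\<^sub>R axis i 1 \<in> D}) = 0"
    if x: "x \<in> D" for x
  proof -
    \<comment> \<open>Derivatives within a set are unique only at limit points of it; the strict
      inequality \<open>a $ i < b $ i\<close> makes \<open>0\<close> one.\<close>
    have "0 \<in> {a $ i - x $ i .. b $ i - x $ i}"
      using x by (auto simp: D mem_box_cart)
    then have "(at 0 within {t. x + t *\<^sub>R axis i 1 \<in> D}) \<noteq> bot"
      using x ab[of i] by (simp add: D box_line trivial_limit_within islimpt_Icc)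
    then show ?thesis
      using vector_derivative_within *[OF x] by blast
  qed
  then show "partial D i f = (\<lambda>x\<in>D. 0)"
    unfolding partial_def by auto
qed

text \<open>Coordinates outside \<open>u\<close> are changed one at a time, each change leaving the
  value of \<open>f\<close> unaffected.\<close>

lemma depends_only_onI:
  fixes a b :: "real ^ 'd::finite"
  assumes D: "D = cbox a b" and f: "\<And>j. j \<notin> u \<Longrightarrow> independent_of D j f"
  shows "depends_only_on D u f"
  unfolding depends_only_on_def
proof (intro ballI impI)
  fix x y assume x: "x \<in> D" and y: "y \<in> D" and xy: "\<forall>k\<in>u. x $ k = y $ k"
  \<comment> \<open>The mixed point \<open>z A\<close> remains in the box because membership is a
    condition on each coordinate separately; it leads from \<open>x\<close> at \<open>A = {}\<close>
    to \<open>y\<close> at \<open>A = - u\<close>.\<close>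
  define z where "z A = (\<chi> k. if k \<in> A then y $ k else x $ k)" for A
  have zD: "z A \<in> D" for A
    using x y by (auto simp: D mem_box_cart z_def)
  have "A \<inter> u = {} \<Longrightarrow> f (z A) = f x" if "finite A" for A
    using that
  proof (induction A)
    case empty
    have "z {} = x"
      by (simp add: z_def)
    then show ?case
      by simp
  next
    case (insert j A)
    have "\<forall>k\<in>UNIV - {j}. z (insert j A) $ k = z A $ k"
      by (simp add: z_def)
    then have "f (z (insert j A)) = f (z A)"
      using f[of j] insert.prems zD unfolding independent_of_def depends_only_on_def by blast
    then show ?case
      using insert by auto
  qed
  then have "f (z (- u)) = f x"
    by simp
  moreover have "z (- u) = y"
    using xy by (simp add: z_def vec_eq_iff)
  ultimately show "f x = f y"
    by simp
qed

section \<open>Freezing a variable\<close>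

definition freeze :: "'d \<Rightarrow> real \<Rightarrow> real ^ 'd::finite \<Rightarrow> real ^ 'd" where
  "freeze i c x = (\<chi> k. if k = i then c else x $ k)"

lemma freeze_in_box:
  "x \<in> cbox a b \<Longrightarrow> a $ i \<le> b $ i \<Longrightarrow> freeze i (a $ i) x \<in> cbox a b"
  by (auto simp: mem_box_cart freeze_def)

lemma freeze_line: "k \<noteq> i \<Longrightarrow> freeze i c (x + t *\<^sub>R axis k 1) = freeze i c x + t *\<^sub>R axis k 1"
  by (auto simp: freeze_def axis_def vec_eq_iff)

lemma continuous_on_freeze: "continuous_on S (freeze i c)"
  unfolding freeze_def
proof (rule continuous_on_vec_lambda)
  show "continuous_on S (\<lambda>x. if k = i then c else x $ k)" for k
    by (cases "k = i") (simp_all add: continuous_on_component)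
qed

section \<open>Regularity of functions with one frozen variable\<close>

context
  fixes a b :: "real ^ 'd::finite" and D :: "(real ^ 'd) set"
  assumes ab: "\<And>i. a $ i < b $ i" and D: "D = cbox a b"
begin

text \<open>Freezing at the endpoint \<open>a $ i\<close> keeps points inside the box; the
  restriction to \<open>D\<close> makes the result extensional.\<close>

abbreviation (input) frozen :: "'d \<Rightarrow> (real ^ 'd \<Rightarrow> real) \<Rightarrow> real ^ 'd \<Rightarrow> real" where
  "frozen i f \<equiv> (\<lambda>x\<in>D. f (freeze i (a $ i) x))"

lemma freeze_in: "x \<in> D \<Longrightarrow> freeze i (a $ i) x \<in> D"
  using ab[of i] freeze_in_box[of x a b i] by (simp add: D less_imp_le)

lemma frozen_independent_of: "independent_of D i (frozen i f)"
proof -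
  have "freeze i c x = freeze i c y" if "\<forall>k\<in>UNIV - {i}. x $ k = y $ k" for x y :: "real ^ 'd" and c
    using that by (auto simp: freeze_def vec_eq_iff)
  then show ?thesis
    unfolding independent_of_def depends_only_on_def by (metis restrict_apply')
qed

lemma continuous_on_frozen:
  assumes "continuous_on D f"
  shows "continuous_on D (frozen i f)"
proof -
  have "continuous_on D (f \<circ> freeze i (a $ i))"
    using freeze_in
    by (intro continuous_on_compose continuous_on_freeze continuous_on_subset[OF assms]) auto
  then show ?thesis
    by (rule continuous_on_eq) auto
qed

text \<open>Moving in direction \<open>k\<close> commutes with freezing coordinate \<open>i\<close>,
  so both sides differentiate the same function within the same interval.\<close>

lemma partial_frozen:
  assumes "k \<noteq> i"
  shows "partially_differentiable D k f \<Longrightarrow> partially_differentiable D k (frozen i f)"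
    and "partial D k (frozen i f) = frozen i (partial D k f)"
proof -
  let ?L = "\<lambda>x. {t. x + t *\<^sub>R axis k 1 \<in> D}"
  have L: "?L (freeze i (a $ i) x) = ?L x" if "x \<in> D" for x
    using that freeze_in[OF that, of i] assms by (simp add: D box_line freeze_def)
  have eq: "frozen i f (x + t *\<^sub>R axis k 1) = f (freeze i (a $ i) x + t *\<^sub>R axis k 1)"
    if "t \<in> ?L x" for x t
    using that assms by (simp add: freeze_line)
  have 0: "0 \<in> ?L x" if "x \<in> D" for x
    using that by simp
  show "partially_differentiable D k (frozen i f)" if f: "partially_differentiable D k f"
    unfolding partially_differentiable_def
  proof
    fix x assume x: "x \<in> D"
    have "(\<lambda>t. f (freeze i (a $ i) x + t *\<^sub>R axis k 1)) differentiable (at 0 within ?L x)"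
      using f freeze_in[OF x] L[OF x] unfolding partially_differentiable_def by metis
    moreover have "(\<lambda>t. frozen i f (x + t *\<^sub>R axis k 1)) differentiable (at 0 within ?L x) \<longleftrightarrow>
        (\<lambda>t. f (freeze i (a $ i) x + t *\<^sub>R axis k 1)) differentiable (at 0 within ?L x)"
      by (rule differentiable_within_cong[OF _ 0[OF x]]) (rule eq)
    ultimately show "(\<lambda>t. frozen i f (x + t *\<^sub>R axis k 1)) differentiable (at 0 within ?L x)"
      by blast
  qed
  show "partial D k (frozen i f) = frozen i (partial D k f)"
  proof
    fix x
    show "partial D k (frozen i f) x = frozen i (partial D k f) x"
    proof (cases "x \<in> D")
      case True
      have "vector_derivative (\<lambda>t. frozen i f (x + t *\<^sub>R axis k 1)) (at 0 within ?L x) =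
          vector_derivative (\<lambda>t. f (freeze i (a $ i) x + t *\<^sub>R axis k 1)) (at 0 within ?L x)"
        by (rule vector_derivative_within_cong[OF _ 0[OF True]]) (rule eq)
      then show ?thesis
        using freeze_in[OF True, of i] L[OF True] True by (simp only: partial_def restrict_apply')
    qed (simp add: partial_def)
  qed
qed

lemma C2_frozen:
  assumes f: "f \<in> C2 D"
  shows "frozen i f \<in> C2 D"
proof -
  have zero: "partially_differentiable D k (\<lambda>x\<in>D. 0) \<and> partial D k (\<lambda>x\<in>D. 0) = (\<lambda>x\<in>D. 0)" for k
    using independent_of_imp_partial_zero[OF ab D, of k "\<lambda>x\<in>D. 0"]
    by (auto simp: independent_of_def depends_only_on_def)
  have cont0: "continuous_on D (\<lambda>x\<in>D. 0 :: real)"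
    by (rule continuous_on_eq[of _ "\<lambda>_. 0"]) auto
  note indep = independent_of_imp_partial_zero[OF ab D frozen_independent_of]
  have first: "partially_differentiable D k (frozen i f) \<and> continuous_on D (partial D k (frozen i f))" for k
  proof (cases "k = i")
    case True
    then show ?thesis using indep cont0 by simp
  next
    case False
    then show ?thesis
      using f partial_frozen[OF False] continuous_on_frozen by (simp add: C2_def)
  qed
  have second: "partially_differentiable D l (partial D k (frozen i f)) \<and>
                continuous_on D (partial2 D l k (frozen i f))" for l k
  proof (cases "k = i")
    case True
    then show ?thesis using indep zero cont0 by (simp add: partial2_def)
  next
    case k: False
    show ?thesis
    proof (cases "l = i")
      \<comment> \<open>The derivative in direction \<open>k\<close> is itself a frozen function,
        hence independent of coordinate \<open>i\<close>.\<close>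
      case True
      then show ?thesis using indep cont0 by (simp add: partial2_def partial_frozen(2)[OF k])
    next
      case False
      then show ?thesis
        using f partial_frozen[OF False] continuous_on_frozen
        by (simp add: C2_def partial2_def partial_frozen(2)[OF k])
    qed
  qed
  have "continuous_on D f"
    using f by (simp add: C2_def)
  then have "continuous_on D (frozen i f)"
    by (rule continuous_on_frozen)
  then show ?thesis
    using first second by (simp add: C2_def)
qed

lemma diff_frozen_independent_of:
  assumes f: "f \<in> C2 D" and "i \<noteq> j" and zero: "\<And>x. x \<in> D \<Longrightarrow> partial2 D i j f x = 0"
  shows "independent_of D j (\<lambda>x\<in>D. f x - frozen i f x)"
proof (rule independent_ofI[OF D])
  fix x assume x: "x \<in> D"
  have diff: "partially_differentiable D j f" "partially_differentiable D i (partial D j f)"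
    using f unfolding C2_def by blast+
  have "independent_of D i (partial D j f)"
    by (rule partial_zero_imp_independent_of[OF D diff(2)]) (use zero in \<open>simp add: partial2_def\<close>)
  moreover have "\<forall>k\<in>UNIV - {i}. freeze i (a $ i) x $ k = x $ k"
    by (simp add: freeze_def)
  ultimately have "partial D j f (freeze i (a $ i) x) = partial D j f x"
    using x freeze_in[OF x, of i] unfolding independent_of_def depends_only_on_def by blast
  then have eq: "partial D j (frozen i f) x = partial D j f x"
    using x \<open>i \<noteq> j\<close> by (simp add: partial_frozen(2))
  have "((\<lambda>t. f (x + t *\<^sub>R axis j 1) - frozen i f (x + t *\<^sub>R axis j 1)) has_vector_derivative
          partial D j f x - partial D j (frozen i f) x) (at 0 within {t. x + t *\<^sub>R axis j 1 \<in> D})"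
    using \<open>i \<noteq> j\<close>
    by (intro has_vector_derivative_diff has_partial[OF _ x] partial_frozen(1) diff) simp
  then have "((\<lambda>t. f (x + t *\<^sub>R axis j 1) - frozen i f (x + t *\<^sub>R axis j 1)) has_vector_derivative 0)
               (at 0 within {t. x + t *\<^sub>R axis j 1 \<in> D})"
    using eq by simp
  then show "((\<lambda>t. (\<lambda>x\<in>D. f x - frozen i f x) (x + t *\<^sub>R axis j 1)) has_vector_derivative 0)
               (at 0 within {t. x + t *\<^sub>R axis j 1 \<in> D})"
    by (rule has_vector_derivative_transform[rotated 2]) (use x in simp_all)
qed

end

section \<open>The decomposition\<close>

lemma function_space_diff:
  assumes "function_space D F" "g \<in> F" "h \<in> F"
  shows "(\<lambda>x\<in>D. g x - h x) \<in> F"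
proof -
  have "(\<lambda>x\<in>D. (-1) * h x) \<in> F"
    using assms unfolding function_space_def by blast
  then have "(\<lambda>x\<in>D. g x + (\<lambda>x\<in>D. (-1) * h x) x) \<in> F"
    using assms unfolding function_space_def by blast
  also have "(\<lambda>x\<in>D. g x + (\<lambda>x\<in>D. (-1) * h x) x) = (\<lambda>x\<in>D. g x - h x)"
    by auto
  finally show ?thesis .
qed

lemma linear_projection_on_diff:
  assumes F: "function_space D F" and T: "linear_projection_on D F T" and "g \<in> F" "h \<in> F"
  shows "T (\<lambda>x\<in>D. g x - h x) = (\<lambda>x\<in>D. T g x - T h x)"
proof -
  let ?m = "\<lambda>x\<in>D. (-1) * h x"
  have m: "?m \<in> F" "T ?m = (\<lambda>x\<in>D. (-1) * T h x)"
    using assms unfolding function_space_def linear_projection_on_def by blast+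
  have "T (\<lambda>x\<in>D. g x - h x) = T (\<lambda>x\<in>D. g x + ?m x)"
    by (rule arg_cong[of _ _ T]) auto
  also have "\<dots> = (\<lambda>x\<in>D. T g x + T ?m x)"
    using T m(1) \<open>g \<in> F\<close> unfolding linear_projection_on_def by blast
  also have "\<dots> = (\<lambda>x\<in>D. T g x - T h x)"
    unfolding m(2) by auto
  finally show ?thesis .
qed

text \<open>Only the algebraic hypotheses are collected here; those linking \<open>P j\<close> to
  the variable \<open>x $ j\<close> enter in the final theorem.\<close>

locale commuting_projections =
  fixes D :: "(real ^ 'd::finite) set" and F :: "(real ^ 'd \<Rightarrow> real) set"
    and P :: "'d \<Rightarrow> (real ^ 'd \<Rightarrow> real) \<Rightarrow> real ^ 'd \<Rightarrow> real"
  assumes F: "function_space D F"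
    and P: "\<And>j. linear_projection_on D F (P j)"
    and P_commute: "\<And>i j g. g \<in> F \<Longrightarrow> P i (P j g) = P j (P i g)"
begin

abbreviation (input) Q :: "'d \<Rightarrow> (real ^ 'd \<Rightarrow> real) \<Rightarrow> real ^ 'd \<Rightarrow> real" where
  "Q j \<equiv> id_minus D (P j)"

lemma P_closed: "g \<in> F \<Longrightarrow> P j g \<in> F"
  using P[of j] unfolding linear_projection_on_def by blast

lemma Q_closed: "g \<in> F \<Longrightarrow> Q j g \<in> F"
  unfolding id_minus_def by (intro function_space_diff[OF F] P_closed)

lemma P_Q_commute: "g \<in> F \<Longrightarrow> P i (Q j g) = Q j (P i g)"
  unfolding id_minus_def
  by (subst linear_projection_on_diff[OF F P]) (auto simp: P_closed P_commute[of g i j])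

lemma Q_Q_commute: "g \<in> F \<Longrightarrow> Q i (Q j g) = Q j (Q i g)"
  unfolding id_minus_def
  by (auto simp: linear_projection_on_diff[OF F P] P_closed P_commute[of g i j])

lemma P_zero: "P j (\<lambda>x\<in>D. 0) = (\<lambda>x\<in>D. 0)"
proof -
  have "(\<lambda>x\<in>D. 0) \<in> F"
    using F unfolding function_space_def by blast
  from linear_projection_on_diff[OF F P this this] show ?thesis
    by (simp cong: restrict_cong)
qed

lemma Q_zero: "Q j (\<lambda>x\<in>D. 0) = (\<lambda>x\<in>D. 0)"
  by (auto simp: id_minus_def P_zero)

text \<open>This expands the product of \<open>P j + Q j = Id\<close> over \<open>j \<in> A\<close>.
  A general \<open>A\<close> permits induction; \<open>A = UNIV\<close> gives the
  decomposition.\<close>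

lemma sum_decomposition:
  assumes f: "f \<in> F" and x: "x \<in> D" and "finite A"
  shows "(\<Sum>u\<in>Pow A. op_prod Q u (op_prod P (A - u) f) x) = f x"
  using \<open>finite A\<close>
proof (induction A)
  case (insert j A)
  let ?s = "\<lambda>A u. op_prod Q u (op_prod P (A - u) f)"
  have fin: "finite u" for u :: "'d set"
    by simp
  have PF: "op_prod P v f \<in> F" for v
    using op_prod_closed[OF fin P_closed f] .
  \<comment> \<open>A subset avoiding the new index gains the factor \<open>P j\<close>, which is
    pulled out past the product of the \<open>Q\<close> operators; a subset containing it gains
    \<open>Q j\<close>.\<close>
  have without: "?s (insert j A) u = P j (?s A u)" if "u \<in> Pow A" for u
  proof -
    have "insert j A - u = insert j (A - u)" "j \<notin> A - u"
      using that insert.hyps by auto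
    then have "op_prod P (insert j A - u) f = P j (op_prod P (A - u) f)"
      using op_prod_insert[of "A - u" j F P f] P_closed P_commute f by simp
    then show ?thesis
      using op_prod_commute[of u F Q "P j"] Q_closed P_Q_commute PF by simp
  qed
  have "with": "?s (insert j A) (insert j u) = Q j (?s A u)" if "u \<in> Pow A" for u
  proof -
    have "insert j A - insert j u = A - u" "j \<notin> u"
      using that insert.hyps by auto
    then show ?thesis
      using op_prod_insert[of u j F Q] Q_closed Q_Q_commute PF by simp
  qed
  have "(\<Sum>u\<in>Pow (insert j A). ?s (insert j A) u x)
      = (\<Sum>u\<in>Pow A. ?s (insert j A) u x) + (\<Sum>u\<in>insert j ` Pow A. ?s (insert j A) u x)"
    unfolding Pow_insert using insert.hyps by (intro sum.union_disjoint) auto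
  also have "(\<Sum>u\<in>insert j ` Pow A. ?s (insert j A) u x)
           = (\<Sum>u\<in>Pow A. ?s (insert j A) (insert j u) x)"
    by (rule sum.reindex[unfolded o_def]) (use insert.hyps in \<open>auto simp: inj_on_def\<close>)
  also have "(\<Sum>u\<in>Pow A. ?s (insert j A) u x) + \<dots> = (\<Sum>u\<in>Pow A. P j (?s A u) x + Q j (?s A u) x)"
    unfolding sum.distrib[symmetric] by (intro sum.cong refl) (simp only: without "with")
  \<comment> \<open>The two contributions of each \<open>u\<close> recombine, since
    \<open>Q j\<close> is the identity minus \<open>P j\<close>.\<close>
  also have "\<dots> = (\<Sum>u\<in>Pow A. ?s A u x)"
    using x by (intro sum.cong) (auto simp: id_minus_def)
  finally show ?case
    using insert.IH by simp
qed simp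

lemma sum_summand:
  assumes "f \<in> F" "x \<in> D"
  shows "f x = (\<Sum>u\<in>UNIV. summand D P f u x)"
  using sum_decomposition[OF assms, of UNIV] by (simp add: summand_def)

text \<open>For \<open>j \<notin> u\<close> the factor \<open>P j\<close> can be moved to the
  outermost position, so the summand inherits independence of \<open>x $ j\<close> from the range of
  \<open>P j\<close>.\<close>

lemma summand_eq_P:
  assumes f: "f \<in> F" and "j \<notin> u"
  obtains g where "g \<in> F" "summand D P f u = P j g"
proof -
  have "UNIV - u = insert j (UNIV - u - {j})"
    using \<open>j \<notin> u\<close> by auto
  then have "op_prod P (UNIV - u) f = P j (op_prod P (UNIV - u - {j}) f)"
    using op_prod_insert[of "UNIV - u - {j}" j F P f] P_closed P_commute f
    by (metis Diff_iff finite insertI1)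
  moreover have PF: "op_prod P (UNIV - u - {j}) f \<in> F"
    using op_prod_closed[of _ F P, OF _ P_closed f] by simp
  ultimately have "summand D P f u = P j (op_prod Q u (op_prod P (UNIV - u - {j}) f))"
    unfolding summand_def using op_prod_commute[of u F Q "P j"] Q_closed P_Q_commute by simp
  then show ?thesis
    using that op_prod_closed[of u F Q, OF _ Q_closed PF] by simp
qed

text \<open>The factor \<open>Q j\<close> is moved to the innermost position, where it acts on
  \<open>f\<close> itself and can annihilate it.\<close>

lemma summand_remove:
  assumes f: "f \<in> F" and "j \<in> u"
  shows "summand D P f u = op_prod Q (u - {j}) (op_prod P (UNIV - u) (Q j f))"
proof -
  have PF: "op_prod P (UNIV - u) f \<in> F"
    using op_prod_closed[of _ F P, OF _ P_closed f] by simp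
  have "summand D P f u = op_prod Q (insert j (u - {j})) (op_prod P (UNIV - u) f)"
    using \<open>j \<in> u\<close> by (simp add: summand_def insert_absorb)
  also have "\<dots> = Q j (op_prod Q (u - {j}) (op_prod P (UNIV - u) f))"
    using op_prod_insert[of "u - {j}" j F Q] Q_closed Q_Q_commute PF by simp
  also have "\<dots> = op_prod Q (u - {j}) (Q j (op_prod P (UNIV - u) f))"
    using op_prod_commute[of "u - {j}" F Q "Q j"] Q_closed Q_Q_commute PF by simp
  also have "Q j (op_prod P (UNIV - u) f) = op_prod P (UNIV - u) (Q j f)"
    using op_prod_commute[of "UNIV - u" F P "Q j"] P_closed P_Q_commute f by simp
  finally show ?thesis .
qed

lemma summand_eq_zero:
  assumes "f \<in> F" "j \<in> u" "Q j f = (\<lambda>x\<in>D. 0)"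
  shows "summand D P f u = (\<lambda>x\<in>D. 0)"
  unfolding summand_remove[OF assms(1,2)] assms(3)
  by (simp only: op_prod_fixed[OF finite, of P, OF P_zero] op_prod_fixed[OF finite, of Q, OF Q_zero])

text \<open>A second factor \<open>Q i\<close> is moved inward as well, next to
  \<open>Q j f\<close>; the remaining operators preserve zero.\<close>

lemma summand_eq_zero2:
  assumes f: "f \<in> F" and u: "i \<in> u" "j \<in> u" "i \<noteq> j" and zero: "Q i (Q j f) = (\<lambda>x\<in>D. 0)"
  shows "summand D P f u = (\<lambda>x\<in>D. 0)"
proof -
  have QF: "Q j f \<in> F"
    using Q_closed f .
  have PF: "op_prod P (UNIV - u) (Q j f) \<in> F"
    using op_prod_closed[of _ F P, OF _ P_closed QF] by simp
  have "summand D P f u = op_prod Q (insert i (u - {j} - {i})) (op_prod P (UNIV - u) (Q j f))"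
    using u by (simp add: summand_remove[OF f u(2)] insert_absorb)
  also have "\<dots> = Q i (op_prod Q (u - {j} - {i}) (op_prod P (UNIV - u) (Q j f)))"
    using op_prod_insert[of "u - {j} - {i}" i F Q] Q_closed Q_Q_commute PF by simp
  also have "\<dots> = op_prod Q (u - {j} - {i}) (Q i (op_prod P (UNIV - u) (Q j f)))"
    using op_prod_commute[of "u - {j} - {i}" F Q "Q i"] Q_closed Q_Q_commute PF by simp
  also have "Q i (op_prod P (UNIV - u) (Q j f)) = op_prod P (UNIV - u) (Q i (Q j f))"
    using op_prod_commute[of "UNIV - u" F P "Q i"] P_closed P_Q_commute QF by simp
  finally show ?thesis
    unfolding zero
    by (simp only: op_prod_fixed[OF finite, of P, OF P_zero] op_prod_fixed[OF finite, of Q, OF Q_zero])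
qed

end

section \<open>Splitting of \<open>f\<close> combined with the operator algebra\<close>

theorem theorem2p5:
  fixes a b :: "real ^ 'd::finite"
    and D :: "(real ^ 'd) set"
    and F :: "(real ^ 'd \<Rightarrow> real) set"
    and P :: "'d \<Rightarrow> (real ^ 'd \<Rightarrow> real) \<Rightarrow> real ^ 'd \<Rightarrow> real"
    and f :: "real ^ 'd \<Rightarrow> real"
  assumes ab: "\<And>i. a $ i < b $ i"
    and D: "D = cbox a b"
    and F: "function_space D F"
    and C2_F: "C2 D \<subseteq> F"
    and P: "\<And>j. linear_projection_on D F (P j)"
    and P_commute: "\<And>i j g. g \<in> F \<Longrightarrow> P i (P j g) = P j (P i g)"
    and P_independent: "\<And>j g. g \<in> F \<Longrightarrow> independent_of D j (P j g)"
    and P_fixes: "\<And>j g. g \<in> F \<Longrightarrow> independent_of D j g \<Longrightarrow> P j g = g"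
    and f: "f \<in> C2 D"
  shows "(\<forall>u. depends_only_on D u (summand D P f u))
    \<and> (\<forall>x\<in>D. f x = (\<Sum>u\<in>UNIV. summand D P f u x))
    \<and> (\<forall>i j. i \<noteq> j \<longrightarrow> (\<forall>x\<in>D. partial2 D i j f x = 0) \<longrightarrow>
         (\<forall>u. {i, j} \<subseteq> u \<longrightarrow> (\<forall>x\<in>D. summand D P f u x = 0)))
    \<and> (\<forall>x\<in>D. f x = (\<Sum>u | is_clique (graph_vertices D f) (graph_edges D f) u. summand D P f u x))"
proof -
  interpret commuting_projections D F P
    by unfold_locales (fact F P P_commute)+
  have fF: "f \<in> F"
    using f C2_F by blast
  have Q_vanish: "id_minus D (P j) g = (\<lambda>x\<in>D. 0)" if "g \<in> F" "independent_of D j g" for j g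
    using P_fixes[OF that] by (auto simp: id_minus_def)
  have dep: "depends_only_on D u (summand D P f u)" for u
  proof (rule depends_only_onI[OF D])
    fix j assume "j \<notin> u"
    then obtain g where "g \<in> F" "summand D P f u = P j g"
      by (rule summand_eq_P[OF fF])
    then show "independent_of D j (summand D P f u)"
      using P_independent by simp
  qed
  have edge: "summand D P f u = (\<lambda>x\<in>D. 0)"
    if "i \<noteq> j" and zero: "\<And>x. x \<in> D \<Longrightarrow> partial2 D i j f x = 0" and u: "i \<in> u" "j \<in> u" for i j u
  proof (rule summand_eq_zero2[OF fF u \<open>i \<noteq> j\<close>])
    let ?g = "\<lambda>x\<in>D. f (freeze i (a $ i) x)"
    let ?h = "\<lambda>x\<in>D. f x - ?g x"
    have gF: "?g \<in> F"
      using C2_frozen[OF ab D f] C2_F by blast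
    have hF: "?h \<in> F"
      using function_space_diff[OF F fF gF] .
    \<comment> \<open>As \<open>?h\<close> is independent of \<open>x $ j\<close>, it is fixed by
      \<open>P j\<close>. Comparison with linearity gives \<open>Q j f = Q j ?g\<close>.\<close>
    have "P j ?h = ?h"
      using diff_frozen_independent_of[OF ab D f \<open>i \<noteq> j\<close> zero] by (intro P_fixes hF)
    moreover have "P j ?h = (\<lambda>x\<in>D. P j f x - P j ?g x)"
      using linear_projection_on_diff[OF F P fF gF] .
    ultimately have h: "?h = (\<lambda>x\<in>D. P j f x - P j ?g x)"
      by simp
    have "f x - P j f x = ?g x - P j ?g x" if "x \<in> D" for x
      using fun_cong[OF h, of x] that by simp
    then have "id_minus D (P j) f = id_minus D (P j) ?g"
      unfolding id_minus_def by (intro restrict_ext)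
    \<comment> \<open>Swapping the two operators lets \<open>Q i\<close> act first on
      \<open>?g\<close>, which it annihilates because \<open>?g\<close> is independent of
      \<open>x $ i\<close>.\<close>
    then have "id_minus D (P i) (id_minus D (P j) f) = id_minus D (P j) (id_minus D (P i) ?g)"
      using Q_Q_commute[OF gF] by simp
    also have "\<dots> = (\<lambda>x\<in>D. 0)"
      using Q_vanish[OF gF frozen_independent_of[OF ab D]] Q_zero by simp
    finally show "id_minus D (P i) (id_minus D (P j) f) = (\<lambda>x\<in>D. 0)" .
  qed
  have vertex: "summand D P f u = (\<lambda>x\<in>D. 0)" if "i \<in> u" "\<And>x. x \<in> D \<Longrightarrow> partial D i f x = 0" for i u
  proof -
    have "independent_of D i f"
      using f that by (intro partial_zero_imp_independent_of[OF D]) (auto simp: C2_def)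
    then show ?thesis
      using summand_eq_zero[OF fF \<open>i \<in> u\<close>] Q_vanish[OF fF] by blast
  qed
  have total: "f x = (\<Sum>u\<in>UNIV. summand D P f u x)" if "x \<in> D" for x
    using sum_summand[OF fF that] .
  have clique: "f x = (\<Sum>u | is_clique (graph_vertices D f) (graph_edges D f) u. summand D P f u x)"
    if x: "x \<in> D" for x
  proof -
    have "summand D P f u x = 0" if "\<not> is_clique (graph_vertices D f) (graph_edges D f) u" for u
    proof -
      \<comment> \<open>A set fails to be a clique through a non-vertex, where \<open>Q i f\<close>
        is zero, or through a missing edge, where \<open>Q i (Q j f)\<close> is zero.\<close>
      from that consider i where "i \<in> u" "i \<notin> graph_vertices D f"
        | i j where "i \<in> u" "j \<in> u" "i \<noteq> j" "(i, j) \<notin> graph_edges D f"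
        unfolding is_clique_def by blast
      then have "summand D P f u = (\<lambda>x\<in>D. 0)"
      proof cases
        case 1
        then show ?thesis
          using vertex unfolding graph_vertices_def by blast
      next
        case 2
        then show ?thesis
          using edge[of i j u] unfolding graph_edges_def by blast
      qed
      then show ?thesis
        using x by simp
    qed
    then show ?thesis
      unfolding total[OF x] by (intro sum.mono_neutral_right) auto
  qed
  show ?thesis
    using dep total edge clique by simp
qed

end
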